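(* Let $I$ be a finite set and let $H$ be a hypergraph over $I$. Then for every nonnegative integer $n$: (1) $\chi_I(H)(n)$ is the number of colorings $S: I\to[n]$ of $H$ such that every nonempty edge of $H$ has exactly one maximal vertex for $S$. (2) $\chi_I(H)(n)$ is also the number of pairs $(f,S)$ where $f$ is an acyclic orientation of $H$, $S$ is a coloring of $H$ with $[n]$, and $f$ and $S$ are strictly compatible. (3) For $f\in\mathcal{A}_H$, let $f(H)\subseteq I$ be the image of $f$ and let $P_{H,f}$ be the set of compositions $P$ of $f(H)$ such that for every nonempty edge $e\in H$ and every $v\in (e\setminus\{f(e)\})\cap f(H)$ one has $P(v)<P(f(e))$. For $P=(P_1,\dots,P_{l(P)})\in P_{H,f}$ define recursively $$\tilde P_i=\Big(\bigcup_{e\in f^{-1}(P_i)} e\Big)\cap (I\setminus f(H))\cap\bigcap_{j<i}(I\setminus\tilde P_j),\qquad p_i=|\tilde P_i|,\qquad 1\le i\le l(P).$$ Let $J_H\subseteq I$ be the set of isolated vertices of $H$, i.e. vertices belonging to no edge of $H$. Then $$\chi_I(H)(n)=n^{|J_H|}\sum_{f\in\mathcal{A}_H}\ \sum_{P\in P_{H,f}}F_{p_1,\dots,p_{l(P)}}(n).$$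
   Context: Notation: $[n]=\{1,\dots,n\}$. A decomposition of a finite set $I$ of length $n$ is a sequence $(S_1,\dots,S_n)$ of pairwise disjoint (possibly empty) sets with union $I$; a composition is a decomposition with no empty part, and $l(P)$ denotes its length. A decomposition $S$ of length $n$ is identified with the function $S:I\to[n]$ with $S(v)=i$ iff $v\in S_i$; compositions correspond to surjections. Hypergraphs. A hypergraph $H$ over a finite set $I$ is a finite multiset of (possibly repeated) subsets of $I$, called edges, containing $\emptyset$ exactly once. Elements of $I$ are vertices. For $I=S\sqcup T$, the restriction $H_{|S}$ is the multiset $\{e\in H: e\subseteq S\}$ (a hypergraph over $S$) and the contraction $H_{/S}$ is the multiset $\{e\cap T: e\in H,\ e\nsubseteq S\}\cup\{\emptyset\}$ (a hypergraph over $T$), multiplicities being kept. The Hopf monoid of hypergraphs has product given by union of edges ($H_1\otimes H_2\mapsto H_1\sqcup H_2$, with $\emptyset$ kept once) and coproduct $\Delta_{S,T}(H)=H_{|S}\otimes H_{/S}$. The iterated coproduct along a decomposition $(S_1,\dots,S_n)$ of $I$ is $\Delta_{S_1,\dots,S_n}(H)=H_1\otimes\cdots\otimes H_n$ with $H_i=(H_{|S_1\sqcup\cdots\sqcup S_i})_{/S_1\sqcup\cdots\sqcup S_{i-1}}$. Basic invariant. A hypergraph is discrete if all its edges have cardinality at most $1$. Let $\zeta(H)=1$ if $H$ is discrete and $\zeta(H)=0$ otherwise. For a nonnegative integer $n$, $$\chi_I(H)(n)=\sum_{(S_1,\dots,S_n)}\zeta(H_1)\cdots\zeta(H_n),$$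 the sum being over all decompositions of $I$ of length $n$, with $\Delta_{S_1,\dots,S_n}(H)=H_1\otimes\cdots\otimes H_n$. (For $n=0$ this is $1$ if $I=\emptyset$ and $0$ otherwise.) It is known that $\chi_I(H)(n)$ is a polynomial in $n$. Colorings and orientations. A coloring of $H$ with $[n]$ is a function $S:I\to[n]$. A vertex $v\in e$ is a maximal vertex of the edge $e$ for $S$ if $S(v)=\max S(e)$. An orientation of $H$ is a function $f$ assigning to each nonempty edge $e$ of $H$ (repeated edges being treated as distinct elements) a vertex $f(e)\in e$. A directed cycle of $f$ is a sequence of distinct edges $e_1,\dots,e_k$ with $f(e_1)\in e_2\setminus\{f(e_2)\},\dots,f(e_{k-1})\in e_k\setminus\{f(e_k)\},\ f(e_k)\in e_1\setminus\{f(e_1)\}$. The orientation is acyclic if it has no directed cycle, and $\mathcal{A}_H$ is the set of acyclic orientations of $H$. An orientation $f$ and a coloring $S$ are strictly compatible if, for every nonempty edge $e$, $f(e)$ is the unique maximal vertex of $e$ for $S$. The functions $F$. For nonnegative integers $p_1,\dots,p_t$ and $n\in\mathbb{N}$, $$F_{p_1,\dots,p_t}(n)=\sum_{0\le k_1<\cdots<k_t\le n-1}k_1^{p_1}\cdots k_t^{p_t},$$ with $0^0=1$, and $F=1$ for the empty sequence ($t=0$). *)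

theory Defs
  imports Main "HOL-Library.Multiset" "HOL-Library.FuncSet" "HOL-Library.Disjoint_Sets"
begin

text \<open>A decomposition \<open>(S\<^sub>1, \<dots>, S\<^sub>n)\<close> is a list of sets; lists are indexed from \<open>0\<close>, so \<open>S\<^sub>i\<close> is
  \<open>Ss ! (i - 1)\<close>.\<close>

definition decompositions :: "'a set \<Rightarrow> nat \<Rightarrow> 'a set list set" where
  "decompositions I n =
     {Ss. length Ss = n \<and> disjoint_family_on (\<lambda>i. Ss ! i) {..<n} \<and> \<Union> (set Ss) = I}"

definition compositions :: "'a set \<Rightarrow> 'a set list set" where
  "compositions I = {P. P \<in> decompositions I (length P) \<and> {} \<notin> set P}"

text \<open>The function \<open>I \<rightarrow> [n]\<close> identified with a decomposition; it takes values in \<open>{1..n}\<close> and is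
  meaningful only for arguments in the union of the parts.\<close>

definition part_of :: "'a set list \<Rightarrow> 'a \<Rightarrow> nat" where
  "part_of Ss v = Suc (THE i. i < length Ss \<and> v \<in> Ss ! i)"

definition hypergraph :: "'a set \<Rightarrow> 'a set multiset \<Rightarrow> bool" where
  "hypergraph I H \<longleftrightarrow> finite I \<and> (\<forall>e\<in>#H. e \<subseteq> I) \<and> count H {} = 1"

definition restriction :: "'a set \<Rightarrow> 'a set multiset \<Rightarrow> 'a set multiset" where
  "restriction S H = {#e \<in># H. e \<subseteq> S#}"

text \<open>\<open>contraction S T H\<close> is \<open>H\<^bsub>/S\<^esub>\<close> for a hypergraph \<open>H\<close> over the disjoint union of \<open>S\<close> and \<open>T\<close>; the
  first summand never contains \<open>{}\<close>.\<close>

definition contraction :: "'a set \<Rightarrow> 'a set \<Rightarrow> 'a set multiset \<Rightarrow> 'a set multiset" where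
  "contraction S T H = {#e \<inter> T. e \<in># {#e \<in># H. \<not> e \<subseteq> S#}#} + {#{}#}"

definition iterated_coproduct :: "'a set list \<Rightarrow> 'a set multiset \<Rightarrow> 'a set multiset list" where
  "iterated_coproduct Ss H =
     map (\<lambda>i. contraction (\<Union>j<i. Ss ! j) (Ss ! i) (restriction (\<Union>j\<le>i. Ss ! j) H))
       [0..<length Ss]"

definition discrete_hypergraph :: "'a set multiset \<Rightarrow> bool" where
  "discrete_hypergraph H \<longleftrightarrow> (\<forall>e\<in>#H. card e \<le> 1)"

definition zeta :: "'a set multiset \<Rightarrow> nat" where
  "zeta H = (if discrete_hypergraph H then 1 else 0)"

definition chi :: "'a set \<Rightarrow> 'a set multiset \<Rightarrow> nat \<Rightarrow> nat" where
  "chi I H n = (\<Sum>Ss\<in>decompositions I n. prod_list (map zeta (iterated_coproduct Ss H)))"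

definition colorings :: "'a set \<Rightarrow> nat \<Rightarrow> ('a \<Rightarrow> nat) set" where
  "colorings I n = I \<rightarrow>\<^sub>E {1..n}"

definition maximal_vertex :: "('a \<Rightarrow> nat) \<Rightarrow> 'a set \<Rightarrow> 'a \<Rightarrow> bool" where
  "maximal_vertex S e v \<longleftrightarrow> v \<in> e \<and> S v = Max (S ` e)"

text \<open>The copies of an edge \<open>e\<close> of multiplicity \<open>m\<close> are kept apart as the pairs
  \<open>(e, 0), \<dots>, (e, m - 1)\<close>.\<close>

definition nonempty_edges :: "'a set multiset \<Rightarrow> ('a set \<times> nat) set" where
  "nonempty_edges H = {(e, k). e \<noteq> {} \<and> k < count H e}"

definition orientations :: "'a set multiset \<Rightarrow> ('a set \<times> nat \<Rightarrow> 'a) set" where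
  "orientations H = (\<Pi>\<^sub>E x\<in>nonempty_edges H. fst x)"

text \<open>Successors of positions in \<open>xs\<close> are taken cyclically.\<close>

definition directed_cycle ::
    "'a set multiset \<Rightarrow> ('a set \<times> nat \<Rightarrow> 'a) \<Rightarrow> ('a set \<times> nat) list \<Rightarrow> bool" where
  "directed_cycle H f xs \<longleftrightarrow>
     xs \<noteq> [] \<and> distinct xs \<and> set xs \<subseteq> nonempty_edges H \<and>
     (\<forall>i<length xs. let y = xs ! (Suc i mod length xs) in f (xs ! i) \<in> fst y - {f y})"

definition acyclic_orientations :: "'a set multiset \<Rightarrow> ('a set \<times> nat \<Rightarrow> 'a) set" where
  "acyclic_orientations H = {f \<in> orientations H. \<nexists>xs. directed_cycle H f xs}"

definition strictly_compatible ::
    "'a set multiset \<Rightarrow> ('a set \<times> nat \<Rightarrow> 'a) \<Rightarrow> ('a \<Rightarrow> nat) \<Rightarrow> bool" where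
  "strictly_compatible H f S \<longleftrightarrow>
     (\<forall>x\<in>nonempty_edges H.
        maximal_vertex S (fst x) (f x) \<and> (\<forall>v. maximal_vertex S (fst x) v \<longrightarrow> v = f x))"

definition F :: "nat list \<Rightarrow> nat \<Rightarrow> nat" where
  "F ps n =
     (\<Sum>ks\<in>{ks. length ks = length ps \<and> sorted_wrt (<) ks \<and> set ks \<subseteq> {..<n}}.
        \<Prod>i<length ps. (ks ! i) ^ (ps ! i))"

definition orientation_image :: "'a set multiset \<Rightarrow> ('a set \<times> nat \<Rightarrow> 'a) \<Rightarrow> 'a set" where
  "orientation_image H f = f ` nonempty_edges H"

definition compatible_compositions ::
    "'a set multiset \<Rightarrow> ('a set \<times> nat \<Rightarrow> 'a) \<Rightarrow> 'a set list set" where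
  "compatible_compositions H f =
     {P \<in> compositions (orientation_image H f).
        \<forall>x\<in>nonempty_edges H. \<forall>v\<in>(fst x - {f x}) \<inter> orientation_image H f.
          part_of P v < part_of P (f x)}"

text \<open>\<open>tilde_part I H f P i\<close> is \<open>\<tilde>P\<^bsub>i+1\<^esub>\<close>, as positions in \<open>P\<close> start at \<open>0\<close>.\<close>

function tilde_part ::
    "'a set \<Rightarrow> 'a set multiset \<Rightarrow> ('a set \<times> nat \<Rightarrow> 'a) \<Rightarrow> 'a set list \<Rightarrow> nat \<Rightarrow> 'a set" where
  "tilde_part I H f P i =
     (\<Union>x\<in>{x \<in> nonempty_edges H. f x \<in> P ! i}. fst x) \<inter> (I - orientation_image H f)
       \<inter> (\<Inter>j\<in>{..<i}. I - tilde_part I H f P j)"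
  by pat_completeness auto
termination
  by (relation "measure (\<lambda>(I, H, f, P, i). i)") auto

declare tilde_part.simps [simp del]

definition isolated_vertices :: "'a set \<Rightarrow> 'a set multiset \<Rightarrow> 'a set" where
  "isolated_vertices I H = {v \<in> I. \<forall>e\<in>#H. v \<notin> e}"

end

theory Submission imports Defs begin

section \<open>Colorings and decompositions\<close>

text \<open>Decompositions of length n are colorings with [n]. In the iterated coproduct along a
  coloring S, a nonempty edge enters only the factor indexed by its largest color, and leaves there
  its set of maximal vertices. Hence the product of the zeta values is 1 exactly when every nonempty
  edge has a unique maximal vertex (\<open>discrete_iterated_coproduct_iff\<close>). Such an S is
  strictly compatible with exactly one orientation, which sends each edge to its maximal vertex;
  colors increase strictly along its directed paths, so it is acyclic
  (\<open>card_colorings_eq_card_pairs\<close>).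

  For the third formula, fix f and count the compatible S. On f(H), S amounts to the composition P
  of its fibres in increasing order of color, together with the colors k_1 + 1 < ... < k_t + 1 that
  occur. An isolated vertex is free and has n choices. Any other vertex v outside f(H) must only
  stay below f(e) for each edge e containing v; the tightest bound comes from the first part P_i
  that contains such an f(e). This is the i for which v lies in the i-th tilde part, and it leaves
  the k_i colors below k_i + 1. So for fixed P and k the colorings form a product set,
  \<open>coloring_box\<close>, whose size is found in \<open>card_coloring_box\<close>. These boxes
  partition the compatible colorings (\<open>coloring_box_subset\<close>,
  \<open>strictly_compatible_in_coloring_box\<close>, \<open>coloring_box_unique\<close>), and
  summing over k gives F.\<close>

lemma part_of_eq:
  assumes "Ss \<in> decompositions I n" "i < n" "v \<in> Ss ! i"
  shows "part_of Ss v = Suc i"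
proof -
  have "(THE i. i < length Ss \<and> v \<in> Ss ! i) = i"
  proof (rule the_equality)
    fix j assume "j < length Ss \<and> v \<in> Ss ! j"
    then show "j = i"
      using assms by (auto simp: decompositions_def disjoint_family_on_def)
  qed (use assms in \<open>auto simp: decompositions_def\<close>)
  then show ?thesis by (simp add: part_of_def)
qed

lemma decomposition_cover:
  assumes "Ss \<in> decompositions I n" "v \<in> I"
  obtains i where "i < n" "v \<in> Ss ! i"
  using assms unfolding decompositions_def by (auto simp: in_set_conv_nth)

lemma decomposition_part_subset:
  assumes "Ss \<in> decompositions I n" "i < n"
  shows "Ss ! i \<subseteq> I"
proof -
  have "Ss ! i \<in> set Ss" using assms by (auto simp: decompositions_def)
  then show ?thesis using assms(1) by (auto simp: decompositions_def)
qed

definition decomposition_of :: "'a set \<Rightarrow> nat \<Rightarrow> ('a \<Rightarrow> nat) \<Rightarrow> 'a set list" where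
  "decomposition_of I n S = map (\<lambda>i. {v \<in> I. S v = Suc i}) [0..<n]"

lemma length_decomposition_of [simp]: "length (decomposition_of I n S) = n"
  by (simp add: decomposition_of_def)

lemma nth_decomposition_of [simp]:
  "i < n \<Longrightarrow> decomposition_of I n S ! i = {v \<in> I. S v = Suc i}"
  by (simp add: decomposition_of_def)

lemma decomposition_of_in_decompositions:
  assumes "S \<in> colorings I n"
  shows "decomposition_of I n S \<in> decompositions I n"
proof -
  have "\<Union> (set (decomposition_of I n S)) = I"
  proof
    show "I \<subseteq> \<Union> (set (decomposition_of I n S))"
    proof
      fix v assume v: "v \<in> I"
      then have "S v \<in> {1..n}" using assms by (auto simp: colorings_def)
      then have "S v - 1 < n" "S v = Suc (S v - 1)" by auto
      with v show "v \<in> \<Union> (set (decomposition_of I n S))"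
        by (force simp: decomposition_of_def)
    qed
  qed (auto simp: decomposition_of_def)
  then show ?thesis
    by (auto simp: decompositions_def disjoint_family_on_def)
qed

lemma bij_betw_decomposition_of:
  "bij_betw (decomposition_of I n) (colorings I n) (decompositions I n)"
proof (rule bij_betw_byWitness[where f' = "\<lambda>Ss. restrict (part_of Ss) I"])
  show "\<forall>S\<in>colorings I n. restrict (part_of (decomposition_of I n S)) I = S"
  proof
    fix S assume S: "S \<in> colorings I n"
    show "restrict (part_of (decomposition_of I n S)) I = S"
    proof (rule PiE_ext)
      show "restrict (part_of (decomposition_of I n S)) I \<in> I \<rightarrow>\<^sub>E UNIV" by auto
      show "S \<in> I \<rightarrow>\<^sub>E UNIV" using S by (auto simp: colorings_def PiE_def)
      fix v assume v: "v \<in> I"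
      then have "S v \<in> {1..n}" using S by (auto simp: colorings_def)
      then have "S v - 1 < n" "S v = Suc (S v - 1)" by auto
      with v part_of_eq[OF decomposition_of_in_decompositions[OF S], of "S v - 1" v]
      show "restrict (part_of (decomposition_of I n S)) I v = S v" by simp
    qed
  qed
  show "\<forall>Ss\<in>decompositions I n. decomposition_of I n (restrict (part_of Ss) I) = Ss"
  proof
    fix Ss :: "'a set list" assume Ss: "Ss \<in> decompositions I n"
    show "decomposition_of I n (restrict (part_of Ss) I) = Ss"
    proof (rule nth_equalityI)
      show "length (decomposition_of I n (restrict (part_of Ss) I)) = length Ss"
        using Ss by (simp add: decompositions_def)
      fix i assume "i < length (decomposition_of I n (restrict (part_of Ss) I))"
      then have i: "i < n" by simp
      have "v \<in> Ss ! i \<longleftrightarrow> part_of Ss v = Suc i" if "v \<in> I" for v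
        using decomposition_cover[OF Ss that] part_of_eq[OF Ss] i by (metis Suc_inject)
      then show "decomposition_of I n (restrict (part_of Ss) I) ! i = Ss ! i"
        using decomposition_part_subset[OF Ss i] i by auto
    qed
  qed
  show "decomposition_of I n ` colorings I n \<subseteq> decompositions I n"
    using decomposition_of_in_decompositions by blast
  show "(\<lambda>Ss. restrict (part_of Ss) I) ` decompositions I n \<subseteq> colorings I n"
  proof -
    have "part_of Ss v \<in> {1..n}" if "Ss \<in> decompositions I n" "v \<in> I" for Ss v
      using decomposition_cover[OF that] part_of_eq[OF that(1)]
      by (metis Suc_leI atLeastAtMost_iff One_nat_def le_simps(3) zero_less_Suc)
    then show ?thesis by (auto simp: colorings_def)
  qed
qed

lemma finite_colorings: "finite I \<Longrightarrow> finite (colorings I n)"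
  by (simp add: colorings_def finite_PiE)

section \<open>The basic invariant counts colorings\<close>

lemma prod_list_zeta:
  "prod_list (map zeta Hs) = of_bool (\<forall>H\<in>set Hs. discrete_hypergraph H)"
  by (induction Hs) (auto simp: zeta_def)

lemma hypergraph_edge:
  assumes "hypergraph I H" "e \<in># H"
  shows "e \<subseteq> I" "finite e"
  using assms by (auto simp: hypergraph_def intro: finite_subset)

text \<open>The extra empty edge of a contraction has cardinality 0, so only the traces of edges
  inside \<open>S'\<close> but not inside \<open>S\<close> impose a condition.\<close>

lemma discrete_contraction_restriction_iff:
  "discrete_hypergraph (contraction S T (restriction S' H)) \<longleftrightarrow>
    (\<forall>e\<in>#H. e \<subseteq> S' \<and> \<not> e \<subseteq> S \<longrightarrow> card (e \<inter> T) \<le> 1)"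
  by (simp add: discrete_hypergraph_def contraction_def restriction_def) blast

text \<open>The trace of an edge in the factor of its largest color is its set of maximal vertices.
  This set is nonempty because edges are finite, so the bound 1 on its cardinality means existence
  and uniqueness.\<close>

lemma discrete_iterated_coproduct_iff:
  assumes H: "hypergraph I H" and S: "S \<in> colorings I n"
  shows "(\<forall>H'\<in>set (iterated_coproduct (decomposition_of I n S) H). discrete_hypergraph H') \<longleftrightarrow>
         (\<forall>e\<in>#H. e \<noteq> {} \<longrightarrow> (\<exists>!v. maximal_vertex S e v))"
proof -
  have S1: "S v \<in> {1..n}" if "v \<in> I" for v
    using S that by (auto simp: colorings_def)
  have S2: "\<exists>j. S v = Suc j" if "v \<in> I" for v
    using S1[OF that] by (cases "S v") auto
  have le: "(\<Union>j\<le>i. decomposition_of I n S ! j) = {v \<in> I. S v \<le> Suc i}" if "i < n" for i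
  proof -
    have "(\<Union>j\<le>i. decomposition_of I n S ! j) = (\<Union>j\<le>i. {v \<in> I. S v = Suc j})"
      using that by auto
    also have "\<dots> = {v \<in> I. S v \<le> Suc i}"
      using S2 by fastforce
    finally show ?thesis .
  qed
  have less: "(\<Union>j<i. decomposition_of I n S ! j) = {v \<in> I. S v \<le> i}" if "i < n" for i
  proof -
    have "(\<Union>j<i. decomposition_of I n S ! j) = (\<Union>j<i. {v \<in> I. S v = Suc j})"
      using that by auto
    also have "\<dots> = {v \<in> I. S v \<le> i}"
      using S2 by fastforce
    finally show ?thesis .
  qed
  \<comment> \<open>Both inclusions are bounds on the largest color of \<open>e\<close>, so together
    they fix its value.\<close>
  have edge: "e \<subseteq> {v \<in> I. S v \<le> Suc i} \<and> \<not> e \<subseteq> {v \<in> I. S v \<le> i} \<longleftrightarrow> Max (S ` e) = Suc i"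
    if e: "e \<in># H" "e \<noteq> {}" for e i
  proof -
    have "e \<subseteq> {v \<in> I. S v \<le> k} \<longleftrightarrow> Max (S ` e) \<le> k" for k
      using hypergraph_edge[OF H e(1)] e(2) by (auto simp: Max_le_iff)
    then show ?thesis by auto
  qed
  have uniq: "card (e \<inter> {v \<in> I. S v = Max (S ` e)}) \<le> 1 \<longleftrightarrow> (\<exists>!v. maximal_vertex S e v)"
    if e: "e \<in># H" "e \<noteq> {}" for e
  proof -
    have eq: "e \<inter> {v \<in> I. S v = Max (S ` e)} = {v. maximal_vertex S e v}"
      using hypergraph_edge[OF H e(1)] by (auto simp: maximal_vertex_def)
    have "Max (S ` e) \<in> S ` e" using hypergraph_edge[OF H e(1)] e(2) by (intro Max_in) auto
    then have "\<exists>v. maximal_vertex S e v" by (auto simp: maximal_vertex_def)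
    moreover have "finite {v. maximal_vertex S e v}"
      using hypergraph_edge[OF H e(1)] by (auto simp: maximal_vertex_def)
    ultimately show ?thesis
      unfolding eq One_nat_def card_le_Suc0_iff_eq[OF \<open>finite {v. maximal_vertex S e v}\<close>] by auto
  qed
  \<comment> \<open>Colors lie in \<open>{1..n}\<close>, so every nonempty edge really occurs in one
    of the \<open>n\<close> factors and is tested there.\<close>
  have range: "\<exists>i<n. Max (S ` e) = Suc i" if e: "e \<in># H" "e \<noteq> {}" for e
  proof -
    have "Max (S ` e) \<in> S ` e" using hypergraph_edge[OF H e(1)] e(2) by (intro Max_in) auto
    then have "Max (S ` e) \<in> {1..n}" using hypergraph_edge[OF H e(1)] S1 by auto
    then show ?thesis by (intro exI[of _ "Max (S ` e) - 1"]) auto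
  qed
  let ?D = "decomposition_of I n S"
  have "(\<forall>H'\<in>set (iterated_coproduct ?D H). discrete_hypergraph H') \<longleftrightarrow>
     (\<forall>i\<in>{0..<n}. \<forall>e\<in>#H. e \<subseteq> (\<Union>j\<le>i. ?D ! j) \<and> \<not> e \<subseteq> (\<Union>j<i. ?D ! j) \<longrightarrow>
                  card (e \<inter> ?D ! i) \<le> 1)"
    by (simp add: iterated_coproduct_def discrete_contraction_restriction_iff
        del: One_nat_def nth_decomposition_of)
  also have "\<dots> \<longleftrightarrow>
     (\<forall>i\<in>{0..<n}. \<forall>e\<in>#H. e \<subseteq> {v \<in> I. S v \<le> Suc i} \<and> \<not> e \<subseteq> {v \<in> I. S v \<le> i} \<longrightarrow>
                  card (e \<inter> {v \<in> I. S v = Suc i}) \<le> 1)"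
    by (rule ball_cong[OF refl]) (simp only: atLeastLessThan_iff le less nth_decomposition_of)
  also have "\<dots> \<longleftrightarrow> (\<forall>e\<in>#H. e \<noteq> {} \<longrightarrow> card (e \<inter> {v \<in> I. S v = Max (S ` e)}) \<le> 1)"
  proof (intro iffI ballI impI)
    fix e
    assume *: "\<forall>i\<in>{0..<n}. \<forall>e\<in>#H. e \<subseteq> {v \<in> I. S v \<le> Suc i} \<and> \<not> e \<subseteq> {v \<in> I. S v \<le> i} \<longrightarrow>
        card (e \<inter> {v \<in> I. S v = Suc i}) \<le> 1"
      and e: "e \<in># H" "e \<noteq> {}"
    obtain i where i: "i < n" "Max (S ` e) = Suc i" using range[OF e] by blast
    then have "card (e \<inter> {v \<in> I. S v = Suc i}) \<le> 1"
      using *[rule_format, of i e] edge[OF e, of i] e(1) by simp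
    then show "card (e \<inter> {v \<in> I. S v = Max (S ` e)}) \<le> 1" by (simp only: i(2))
  next
    fix i e
    assume *: "\<forall>e\<in>#H. e \<noteq> {} \<longrightarrow> card (e \<inter> {v \<in> I. S v = Max (S ` e)}) \<le> 1"
      and e: "e \<in># H" "e \<subseteq> {v \<in> I. S v \<le> Suc i} \<and> \<not> e \<subseteq> {v \<in> I. S v \<le> i}"
    then have ne: "e \<noteq> {}" by auto
    then have "Max (S ` e) = Suc i" using edge[OF e(1)] e(2) by blast
    then show "card (e \<inter> {v \<in> I. S v = Suc i}) \<le> 1" using *[rule_format, OF e(1) ne] by (simp only:)
  qed
  also have "\<dots> \<longleftrightarrow> (\<forall>e\<in>#H. e \<noteq> {} \<longrightarrow> (\<exists>!v. maximal_vertex S e v))"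
    using uniq by (intro ball_cong imp_cong refl)
  finally show ?thesis .
qed

lemma chi_eq_card_colorings:
  assumes H: "hypergraph I H"
  shows "chi I H n =
    card {S \<in> colorings I n. \<forall>e\<in>#H. e \<noteq> {} \<longrightarrow> (\<exists>!v. maximal_vertex S e v)}"
proof -
  have "chi I H n = (\<Sum>S\<in>colorings I n.
      prod_list (map zeta (iterated_coproduct (decomposition_of I n S) H)))"
    unfolding chi_def by (rule sum.reindex_bij_betw[OF bij_betw_decomposition_of, symmetric])
  also have "\<dots> = (\<Sum>S\<in>colorings I n.
      of_bool (\<forall>e\<in>#H. e \<noteq> {} \<longrightarrow> (\<exists>!v. maximal_vertex S e v)))"
    using discrete_iterated_coproduct_iff[OF H] by (intro sum.cong) (auto simp: prod_list_zeta)
  also have "\<dots> = card {S \<in> colorings I n. \<forall>e\<in>#H. e \<noteq> {} \<longrightarrow> (\<exists>!v. maximal_vertex S e v)}"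
    using finite_colorings[of I n] H
    by (simp add: hypergraph_def sum_of_bool_eq Int_def)
  finally show ?thesis .
qed

section \<open>Acyclic orientations\<close>

lemma nonempty_edgesD:
  assumes "hypergraph I H" "x \<in> nonempty_edges H"
  shows "fst x \<in># H" "fst x \<noteq> {}" "fst x \<subseteq> I" "finite (fst x)"
  using assms hypergraph_edge[OF assms(1), of "fst x"]
  by (auto simp: nonempty_edges_def count_greater_zero_iff[symmetric] simp del: count_greater_zero_iff)

lemma nonempty_edgesI: "e \<in># H \<Longrightarrow> e \<noteq> {} \<Longrightarrow> (e, 0) \<in> nonempty_edges H"
  by (simp add: nonempty_edges_def)

lemma finite_nonempty_edges: "finite (nonempty_edges H)"
proof -
  have "nonempty_edges H \<subseteq> (SIGMA e:set_mset H. {..<count H e})"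
    by (auto simp: nonempty_edges_def count_greater_zero_iff[symmetric] simp del: count_greater_zero_iff)
  then show ?thesis by (rule finite_subset) auto
qed

lemma finite_acyclic_orientations:
  assumes "hypergraph I H"
  shows "finite (acyclic_orientations H)"
proof -
  have "finite (orientations H)"
    unfolding orientations_def using nonempty_edgesD[OF assms] finite_nonempty_edges
    by (intro finite_PiE) auto
  then show ?thesis by (simp add: acyclic_orientations_def)
qed

lemma orientation_in_edge:
  "f \<in> orientations H \<Longrightarrow> x \<in> nonempty_edges H \<Longrightarrow> f x \<in> fst x"
  by (auto simp: orientations_def)

text \<open>In a finite edge, being the only maximum means beating every other vertex strictly. The
  condition thus becomes a system of inequalities between colors of single vertices, which the
  counting uses.\<close>

lemma strictly_compatible_iff:
  assumes H: "hypergraph I H" and f: "f \<in> orientations H"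
  shows "strictly_compatible H f S \<longleftrightarrow>
    (\<forall>x\<in>nonempty_edges H. \<forall>v\<in>fst x - {f x}. S v < S (f x))"
proof -
  have "maximal_vertex S (fst x) (f x) \<and> (\<forall>v. maximal_vertex S (fst x) v \<longrightarrow> v = f x) \<longleftrightarrow>
    (\<forall>v\<in>fst x - {f x}. S v < S (f x))" if x: "x \<in> nonempty_edges H" for x
  proof -
    note fin = nonempty_edgesD(4)[OF H x] and fx = orientation_in_edge[OF f x]
    have max: "maximal_vertex S (fst x) v \<longleftrightarrow> v \<in> fst x \<and> (\<forall>w\<in>fst x. S w \<le> S v)" for v
    proof -
      have "S v = Max (S ` fst x) \<longleftrightarrow> (\<forall>w\<in>fst x. S w \<le> S v)" if "v \<in> fst x"
        using fin that by (subst eq_commute, subst Max_eq_iff) auto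
      then show ?thesis by (auto simp: maximal_vertex_def)
    qed
    show ?thesis unfolding max
    proof (intro iffI ballI conjI allI impI)
      fix v assume *: "(f x \<in> fst x \<and> (\<forall>w\<in>fst x. S w \<le> S (f x))) \<and>
        (\<forall>v. v \<in> fst x \<and> (\<forall>w\<in>fst x. S w \<le> S v) \<longrightarrow> v = f x)" "v \<in> fst x - {f x}"
      have "S v \<le> S (f x)" using * by blast
      moreover have "S v \<noteq> S (f x)"
      proof
        assume "S v = S (f x)"
        then have "\<forall>w\<in>fst x. S w \<le> S v" using *(1) by simp
        then show False using * by blast
      qed
      ultimately show "S v < S (f x)" by simp
    next
      fix w assume "\<forall>v\<in>fst x - {f x}. S v < S (f x)" "w \<in> fst x"
      then show "S w \<le> S (f x)" by (cases "w = f x") (auto simp: less_imp_le)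
    next
      fix v assume "\<forall>v\<in>fst x - {f x}. S v < S (f x)" "v \<in> fst x \<and> (\<forall>w\<in>fst x. S w \<le> S v)"
      then show "v = f x" using fx by (meson DiffI linorder_not_less singletonD)
    qed (rule fx)
  qed
  then show ?thesis by (simp add: strictly_compatible_def)
qed

text \<open>Along a directed cycle the colors of the vertices \<open>f (e\<^sub>i)\<close> would strictly increase.\<close>

lemma strictly_compatible_acyclic:
  assumes H: "hypergraph I H" and f: "f \<in> orientations H" and c: "strictly_compatible H f S"
  shows "f \<in> acyclic_orientations H"
proof -
  have False if cyc: "directed_cycle H f xs" for xs
  proof -
    let ?c = "\<lambda>i. S (f (xs ! i))"
    have ne: "0 < length xs" using cyc by (simp add: directed_cycle_def)
    \<comment> \<open>A position of largest color is chosen; its cyclic successor would carry a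
      still larger one.\<close>
    have "Max (?c ` {..<length xs}) \<in> ?c ` {..<length xs}"
      using ne by (intro Max_in) auto
    then obtain i where i: "i < length xs" "Max (?c ` {..<length xs}) = ?c i" by auto
    let ?j = "Suc i mod length xs"
    have j: "?j < length xs" using ne by simp
    then have "xs ! ?j \<in> nonempty_edges H" using cyc by (auto simp: directed_cycle_def)
    moreover have "f (xs ! i) \<in> fst (xs ! ?j) - {f (xs ! ?j)}"
      using cyc i(1) by (simp add: directed_cycle_def Let_def)
    ultimately have "?c i < ?c ?j"
      using c unfolding strictly_compatible_iff[OF H f] by blast
    moreover have "?c ?j \<le> ?c i"
      unfolding i(2)[symmetric] using j by (intro Max_ge) auto
    ultimately show False by simp
  qed
  then show ?thesis using f by (auto simp: acyclic_orientations_def)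
qed

text \<open>Projection to the coloring is a bijection: a compatible \<open>f\<close> must send each
  edge to its only maximal vertex, and conversely this rule defines an orientation, which is acyclic
  by \<open>strictly_compatible_acyclic\<close>.\<close>

lemma card_colorings_eq_card_pairs:
  assumes H: "hypergraph I H"
  shows "card {S \<in> colorings I n. \<forall>e\<in>#H. e \<noteq> {} \<longrightarrow> (\<exists>!v. maximal_vertex S e v)} =
    card {(f, S). f \<in> acyclic_orientations H \<and> S \<in> colorings I n \<and> strictly_compatible H f S}"
    (is "card ?C = card ?P")
proof -
  have inj: "inj_on snd ?P"
  proof (rule inj_onI, clarsimp)
    fix f g S
    assume f: "f \<in> acyclic_orientations H" and g: "g \<in> acyclic_orientations H"
      and "strictly_compatible H f S" "strictly_compatible H g S"
    then have "f x = g x" if "x \<in> nonempty_edges H" for x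
      using that unfolding strictly_compatible_def by metis
    moreover have "f \<in> orientations H" "g \<in> orientations H"
      using f g by (simp_all add: acyclic_orientations_def)
    ultimately show "f = g" unfolding orientations_def by (metis PiE_ext)
  qed
  have img: "snd ` ?P = ?C"
  proof
    show "snd ` ?P \<subseteq> ?C"
    proof clarsimp
      fix f S e assume "strictly_compatible H f S" "e \<in># H" "e \<noteq> {}"
      \<comment> \<open>The copy \<open>(e, 0)\<close> suffices, since the maximal vertices of an
        edge do not depend on the copy.\<close>
      then show "\<exists>!v. maximal_vertex S e v"
        unfolding strictly_compatible_def using nonempty_edgesI[of e H] by (metis fst_conv)
    qed
    show "?C \<subseteq> snd ` ?P"
    proof
      fix S assume S: "S \<in> ?C"
      define f where "f = (\<lambda>x\<in>nonempty_edges H. THE v. maximal_vertex S (fst x) v)"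
      have fx: "maximal_vertex S (fst x) (f x) \<and> (\<forall>v. maximal_vertex S (fst x) v \<longrightarrow> v = f x)"
        if x: "x \<in> nonempty_edges H" for x
      proof -
        have "\<exists>!v. maximal_vertex S (fst x) v"
          using S nonempty_edgesD[OF H x] by blast
        from theI'[OF this] this show ?thesis using x unfolding f_def by auto
      qed
      then have "f \<in> orientations H"
        by (auto simp: orientations_def f_def maximal_vertex_def)
      moreover from fx have "strictly_compatible H f S" by (simp add: strictly_compatible_def)
      ultimately have "(f, S) \<in> ?P"
        using S strictly_compatible_acyclic[OF H, of f S] by simp
      then show "S \<in> snd ` ?P" by (rule image_eqI[rotated]) simp
    qed
  qed
  show ?thesis using card_image[OF inj] unfolding img .
qed

section \<open>Colorings strictly compatible with a fixed orientation\<close>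

text \<open>The candidates for \<open>tilde_part\<close> before earlier parts are removed: under a
  compatible coloring, the vertices outside the image of \<open>f\<close> that have to stay below
  the color of some vertex in \<open>P ! i\<close>.\<close>

definition covered_by ::
    "'a set \<Rightarrow> 'a set multiset \<Rightarrow> ('a set \<times> nat \<Rightarrow> 'a) \<Rightarrow> 'a set list \<Rightarrow> nat \<Rightarrow> 'a set" where
  "covered_by I H f P i =
     (\<Union>x\<in>{x \<in> nonempty_edges H. f x \<in> P ! i}. fst x) \<inter> (I - orientation_image H f)"

text \<open>Removing the earlier tilde parts or the earlier \<open>covered_by\<close> sets is the
  same, as both have the same union. So \<open>tilde_part\<close> at \<open>i\<close> collects the
  vertices whose least covering index is \<open>i\<close>, and disjointness follows.\<close>

lemma tilde_part_eq_disjointed: "tilde_part I H f P i = disjointed (covered_by I H f P) i"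
proof (induction i rule: less_induct)
  case (less i)
  have "tilde_part I H f P i = covered_by I H f P i \<inter> (\<Inter>j\<in>{..<i}. I - tilde_part I H f P j)"
    by (subst tilde_part.simps) (simp add: covered_by_def)
  also have "\<dots> = covered_by I H f P i - (\<Union>j\<in>{0..<i}. tilde_part I H f P j)"
    by (auto simp: covered_by_def)
  also have "(\<Union>j\<in>{0..<i}. tilde_part I H f P j) = (\<Union>j\<in>{0..<i}. disjointed (covered_by I H f P) j)"
    using less by auto
  also have "\<dots> = (\<Union>j\<in>{0..<i}. covered_by I H f P j)"
    by (rule finite_UN_disjointed_eq)
  finally show ?case by (simp add: disjointed_def)
qed

text \<open>Disjoint nonempty parts are distinct, so a composition is a list of subsets of
  \<open>V\<close> without repetition.\<close>

lemma finite_compositions: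
  assumes "finite V"
  shows "finite (compositions V)"
proof -
  have "compositions V \<subseteq> {P. set P \<subseteq> Pow V \<and> distinct P}"
  proof
    fix P assume "P \<in> compositions V"
    then have P: "disjoint_family_on (\<lambda>i. P ! i) {..<length P}" "\<Union> (set P) = V" "{} \<notin> set P"
      by (auto simp: compositions_def decompositions_def)
    have "P ! i \<noteq> P ! j" if ij: "i < length P" "j < length P" "i \<noteq> j" for i j
    proof
      assume "P ! i = P ! j"
      then have "P ! i = {}" using P(1) ij by (auto simp: disjoint_family_on_def)
      then show False using P(3) nth_mem[OF ij(1)] by metis
    qed
    then show "P \<in> {P. set P \<subseteq> Pow V \<and> distinct P}"
      using P(2) by (auto simp: distinct_conv_nth)
  qed
  then show ?thesis by (rule finite_subset) (use assms in \<open>simp add: finite_subset_distinct\<close>)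
qed

text \<open>The index set of the sum \<open>F\<close>; an entry \<open>k\<close> stands for the
  color \<open>k + 1\<close>.\<close>

definition color_lists :: "nat \<Rightarrow> nat \<Rightarrow> nat list set" where
  "color_lists t n = {ks. length ks = t \<and> sorted_wrt (<) ks \<and> set ks \<subseteq> {..<n}}"

lemma finite_color_lists: "finite (color_lists t n)"
  by (rule finite_subset[OF _ finite_lists_length_eq[of "{..<n}" t]]) (auto simp: color_lists_def)

text \<open>The colorings whose fibres over \<open>f(H)\<close>, in increasing order of color, are the parts of \<open>P\<close>,
  with colors \<open>k\<^sub>1 + 1 < \<dots> < k\<^sub>t + 1\<close>. A vertex outside \<open>f(H)\<close> has to stay below \<open>f e\<close> for all edges
  \<open>e\<close> containing it, and the first part meeting these \<open>f e\<close> gives the strongest constraint.\<close>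

definition coloring_box ::
    "'a set \<Rightarrow> 'a set multiset \<Rightarrow> ('a set \<times> nat \<Rightarrow> 'a) \<Rightarrow> nat \<Rightarrow> 'a set list \<Rightarrow> nat list \<Rightarrow> ('a \<Rightarrow> nat) set"
  where
  "coloring_box I H f n P ks =
     (\<Pi>\<^sub>E v\<in>I. {c \<in> {1..n}. \<forall>i<length P. (v \<in> P ! i \<longrightarrow> c = Suc (ks ! i)) \<and>
                                        (v \<in> tilde_part I H f P i \<longrightarrow> c \<le> ks ! i)})"

section \<open>The cardinality of a box of colorings\<close>

lemma orientation_image_subset:
  assumes "hypergraph I H" "f \<in> orientations H"
  shows "orientation_image H f \<subseteq> I"
  using nonempty_edgesD(3)[OF assms(1)] orientation_in_edge[OF assms(2)]
  unfolding orientation_image_def by blast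

text \<open>A vertex that is neither isolated nor in the image lies in some edge, whose chosen
  vertex lies in a part \<open>P ! i\<close>; hence it is covered at \<open>i\<close>. The three
  kinds of vertices receive different numbers of colors.\<close>

lemma vertices_eq:
  assumes H: "hypergraph I H" and f: "f \<in> orientations H"
    and P: "P \<in> compositions (orientation_image H f)"
  shows "I = isolated_vertices I H \<union>
    (orientation_image H f \<union> (\<Union>i<length P. tilde_part I H f P i))"
proof -
  have P': "P \<in> decompositions (orientation_image H f) (length P)"
    using P by (simp add: compositions_def)
  have cov: "(\<Union>i<length P. tilde_part I H f P i) = (\<Union>i<length P. covered_by I H f P i)"
    unfolding tilde_part_eq_disjointed atLeast0LessThan[symmetric] by (rule finite_UN_disjointed_eq)
  have "v \<in> (\<Union>i<length P. covered_by I H f P i)"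
    if v: "v \<in> I" "v \<notin> isolated_vertices I H" "v \<notin> orientation_image H f" for v
  proof -
    obtain e where e: "e \<in># H" "v \<in> e" using v by (auto simp: isolated_vertices_def)
    then have x: "(e, 0) \<in> nonempty_edges H" by (intro nonempty_edgesI) auto
    then have "f (e, 0) \<in> orientation_image H f" by (simp add: orientation_image_def)
    from decomposition_cover[OF P' this] obtain i where "i < length P" "f (e, 0) \<in> P ! i" .
    then show ?thesis using v e(2) x by (force simp: covered_by_def)
  qed
  moreover have "isolated_vertices I H \<subseteq> I" "covered_by I H f P i \<subseteq> I" for i
    by (auto simp: isolated_vertices_def covered_by_def)
  ultimately show ?thesis
    using orientation_image_subset[OF H f] unfolding cov by blast
qed

text \<open>The box is a product over vertices, so the numbers of admissible colors multiply:
  \<open>n\<close> at an isolated vertex, 1 in the image of \<open>f\<close>, and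
  \<open>ks ! i\<close> in the tilde part at \<open>i\<close>.\<close>

lemma card_coloring_box:
  assumes H: "hypergraph I H" and f: "f \<in> orientations H"
    and P: "P \<in> compositions (orientation_image H f)" and ks: "ks \<in> color_lists (length P) n"
  shows "card (coloring_box I H f n P ks) = n ^ card (isolated_vertices I H) *
    (\<Prod>i<length P. (ks ! i) ^ card (tilde_part I H f P i))"
proof -
  let ?V = "orientation_image H f" and ?J = "isolated_vertices I H" and ?T = "tilde_part I H f P"
  define B where "B v = {c \<in> {1..n}. \<forall>i<length P. (v \<in> P ! i \<longrightarrow> c = Suc (ks ! i)) \<and>
                                        (v \<in> ?T i \<longrightarrow> c \<le> ks ! i)}" for v
  have P': "P \<in> decompositions ?V (length P)" using P by (simp add: compositions_def)
  have fin: "finite I" using H by (simp add: hypergraph_def)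
  \<comment> \<open>This keeps \<open>Suc (ks ! i)\<close> within \<open>{1..n}\<close> and ensures
    that \<open>n\<close> does not cut off \<open>{1..ks ! i}\<close>.\<close>
  have ksn: "ks ! i < n" if "i < length P" for i
  proof -
    have "length ks = length P" "set ks \<subseteq> {..<n}" using ks by (auto simp: color_lists_def)
    then show ?thesis using that subsetD[of "set ks" "{..<n}" "ks ! i"] by simp
  qed
  have TV: "?T i \<inter> ?V = {}" "?T i \<subseteq> I" for i
    by (auto simp: tilde_part_eq_disjointed disjointed_def covered_by_def)
  have TJ: "?T i \<inter> ?J = {}" for i
    using nonempty_edgesD[OF H]
    by (fastforce simp: tilde_part_eq_disjointed disjointed_def covered_by_def isolated_vertices_def)
  have VJ: "?V \<inter> ?J = {}"
    using nonempty_edgesD(1)[OF H] orientation_in_edge[OF f]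
    by (fastforce simp: orientation_image_def isolated_vertices_def)
  have Tdisj: "i = j" if "v \<in> ?T i" "v \<in> ?T j" for v i j
    using disjoint_family_disjointed[of "covered_by I H f P"] that
    by (auto simp: disjoint_family_on_def tilde_part_eq_disjointed)
  have PV: "P ! i \<subseteq> ?V" if "i < length P" for i
    using decomposition_part_subset[OF P' that] .
  have VI: "?V \<subseteq> I" by (rule orientation_image_subset[OF H f])
  have J: "card (B v) = n" if "v \<in> ?J" for v
  proof -
    have "B v = {1..n}" using that PV TJ VJ by (fastforce simp: B_def)
    then show ?thesis by simp
  qed
  have V: "card (B v) = 1" if v: "v \<in> ?V" for v
  proof -
    obtain i where i: "i < length P" "v \<in> P ! i" by (rule decomposition_cover[OF P' v])
    have "v \<in> P ! j \<longleftrightarrow> j = i" if "j < length P" for j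
      using part_of_eq[OF P' i] part_of_eq[OF P' that] i(2) by auto
    moreover have "v \<notin> ?T j" for j using TV(1) v by auto
    ultimately have "c \<in> B v \<longleftrightarrow> c = Suc (ks ! i)" for c
      using i(1) ksn[OF i(1)] by (auto simp: B_def)
    then have "B v = {Suc (ks ! i)}" by auto
    then show ?thesis by simp
  qed
  \<comment> \<open>Exactly \<open>ks ! i\<close> colors lie below \<open>Suc (ks ! i)\<close>. If
    \<open>ks ! i\<close> is 0, a nonempty tilde part empties the box, while an empty one
    contributes the factor \<open>0 ^ 0 = 1\<close>.\<close>
  have T: "card (B v) = ks ! i" if v: "v \<in> ?T i" and i: "i < length P" for v i
  proof -
    have "v \<notin> P ! j" if "j < length P" for j using v TV(1)[of i] PV[OF that] by auto
    moreover have "v \<in> ?T j \<longleftrightarrow> j = i" for j using v Tdisj by blast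
    ultimately have "c \<in> B v \<longleftrightarrow> c \<in> {1..ks ! i}" for c
      using i ksn[OF i] by (auto simp: B_def)
    then have "B v = {1..ks ! i}" by blast
    then show ?thesis by simp
  qed
  have finT: "finite (?T i)" and finV: "finite ?V" and finJ: "finite ?J" for i
    using fin TV(2) VI by (auto simp: isolated_vertices_def intro: finite_subset)
  have "card (coloring_box I H f n P ks) = (\<Prod>v\<in>I. card (B v))"
    unfolding coloring_box_def B_def using fin by (rule card_PiE)
  also have "\<dots> = (\<Prod>v\<in>?J \<union> (?V \<union> (\<Union>i<length P. ?T i)). card (B v))"
    using vertices_eq[OF H f P] by simp
  also have "\<dots> = (\<Prod>v\<in>?J. card (B v)) * (\<Prod>v\<in>?V \<union> (\<Union>i<length P. ?T i). card (B v))"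
  proof (rule prod.union_disjoint)
    show "?J \<inter> (?V \<union> (\<Union>i<length P. ?T i)) = {}" using TJ VJ by blast
  qed (simp_all add: finT finV finJ)
  also have "(\<Prod>v\<in>?V \<union> (\<Union>i<length P. ?T i). card (B v)) =
      (\<Prod>v\<in>?V. card (B v)) * (\<Prod>v\<in>(\<Union>i<length P. ?T i). card (B v))"
  proof (rule prod.union_disjoint)
    show "?V \<inter> (\<Union>i<length P. ?T i) = {}" using TV(1) by blast
  qed (simp_all add: finT finV)
  also have "(\<Prod>v\<in>(\<Union>i<length P. ?T i). card (B v)) = (\<Prod>i<length P. \<Prod>v\<in>?T i. card (B v))"
    using finT Tdisj by (intro prod.UNION_disjoint) auto
  also have "\<dots> = (\<Prod>i<length P. (ks ! i) ^ card (?T i))"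
    using T by (intro prod.cong) auto
  also have "(\<Prod>v\<in>?J. card (B v)) = n ^ card ?J" using J by simp
  also have "(\<Prod>v\<in>?V. card (B v)) = 1" using V by simp
  finally show ?thesis by simp
qed

section \<open>The boxes partition the strictly compatible colorings\<close>

text \<open>Let \<open>f x\<close> lie in \<open>P ! j\<close>. A vertex of the edge in the image
  lies in an earlier part, and \<open>ks\<close> increases. A vertex outside the image is covered at
  \<open>j\<close>, so it lies in the tilde part of some \<open>i \<le> j\<close>, and its color is
  at most \<open>ks ! i \<le> ks ! j\<close>, below that of \<open>f x\<close>.\<close>

lemma coloring_box_subset:
  assumes H: "hypergraph I H" and f: "f \<in> orientations H"
    and P: "P \<in> compatible_compositions H f" and ks: "ks \<in> color_lists (length P) n"
  shows "coloring_box I H f n P ks \<subseteq> {S \<in> colorings I n. strictly_compatible H f S}"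
proof
  fix S assume S: "S \<in> coloring_box I H f n P ks"
  let ?V = "orientation_image H f" and ?T = "tilde_part I H f P"
  have P1: "P \<in> compositions ?V" using P by (simp add: compatible_compositions_def)
  then have P': "P \<in> decompositions ?V (length P)" by (simp add: compositions_def)
  have SP: "S v = Suc (ks ! i)" if "i < length P" "v \<in> P ! i" for v i
    using S that decomposition_part_subset[OF P' that(1)] orientation_image_subset[OF H f]
    by (auto simp: coloring_box_def PiE_iff)
  have ST: "S v \<le> ks ! i" if "i < length P" "v \<in> ?T i" for v i
  proof -
    have "v \<in> I" using that by (auto simp: tilde_part_eq_disjointed disjointed_def covered_by_def)
    then show ?thesis using S that by (auto simp: coloring_box_def PiE_iff)
  qed
  have mono: "ks ! i \<le> ks ! j" if "i \<le> j" "j < length P" for i j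
    using ks that by (cases "i = j") (auto simp: color_lists_def sorted_wrt_iff_nth_less less_imp_le)
  have "S v < S (f x)" if x: "x \<in> nonempty_edges H" and v: "v \<in> fst x - {f x}" for x v
  proof -
    have fxV: "f x \<in> ?V" using x by (simp add: orientation_image_def)
    obtain j where j: "j < length P" "f x \<in> P ! j" by (rule decomposition_cover[OF P' fxV])
    show ?thesis
    proof (cases "v \<in> ?V")
      case True
      obtain i where i: "i < length P" "v \<in> P ! i" by (rule decomposition_cover[OF P' True])
      have "part_of P v < part_of P (f x)"
        using P x v True by (auto simp: compatible_compositions_def)
      then have "i < j" by (simp add: part_of_eq[OF P' i] part_of_eq[OF P' j])
      then have "ks ! i < ks ! j"
        using ks j by (auto simp: color_lists_def sorted_wrt_iff_nth_less)
      then show ?thesis by (simp add: SP[OF i] SP[OF j])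
    next
      case False
      then have "v \<in> covered_by I H f P j"
        using x v j(2) nonempty_edgesD(3)[OF H x] unfolding covered_by_def by blast
      \<comment> \<open>The argument passes through partial unions because \<open>v\<close> may
        already belong to a tilde part before \<open>j\<close>.\<close>
      then have "v \<in> (\<Union>i\<in>{0..<Suc j}. covered_by I H f P i)" by auto
      then have "v \<in> (\<Union>i\<in>{0..<Suc j}. ?T i)"
        unfolding tilde_part_eq_disjointed finite_UN_disjointed_eq .
      then obtain i where i: "i \<le> j" "v \<in> ?T i" by (auto simp: less_Suc_eq_le)
      then have "S v \<le> ks ! i" using ST j(1) by simp
      also have "\<dots> \<le> ks ! j" using mono i(1) j(1) by simp
      finally show ?thesis by (simp add: SP[OF j])
    qed
  qed
  moreover have "S \<in> colorings I n" using S by (auto simp: coloring_box_def colorings_def PiE_iff)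
  ultimately show "S \<in> {S \<in> colorings I n. strictly_compatible H f S}"
    by (simp add: strictly_compatible_iff[OF H f])
qed

text \<open>The witnesses are read off from \<open>S\<close>: \<open>ks\<close> lists the colors
  used on the image of \<open>f\<close>, lowered by one, and \<open>P\<close> lists their fibres. A
  vertex in the tilde part at \<open>i\<close> shares an edge with a chosen vertex of color
  \<open>Suc (ks ! i)\<close>, which bounds its color by \<open>ks ! i\<close>.\<close>

lemma strictly_compatible_in_coloring_box:
  assumes H: "hypergraph I H" and f: "f \<in> orientations H"
    and S: "S \<in> colorings I n" and c: "strictly_compatible H f S"
  shows "\<exists>P\<in>compatible_compositions H f. \<exists>ks\<in>color_lists (length P) n.
           S \<in> coloring_box I H f n P ks"
proof -
  let ?V = "orientation_image H f"
  have VI: "?V \<subseteq> I" by (rule orientation_image_subset[OF H f])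
  then have finV: "finite ?V" using H by (auto simp: hypergraph_def intro: finite_subset)
  have S1: "S v \<in> {1..n}" if "v \<in> I" for v
    using S that by (auto simp: colorings_def)
  have less: "S v < S (f x)" if "x \<in> nonempty_edges H" "v \<in> fst x" "v \<noteq> f x" for x v
    using c that by (simp add: strictly_compatible_iff[OF H f])
  \<comment> \<open>Colors are at least 1, so the truncated subtraction loses nothing.\<close>
  define ks where "ks = sorted_list_of_set ((\<lambda>v. S v - 1) ` ?V)"
  define P where "P = map (\<lambda>k. {v \<in> ?V. S v = Suc k}) ks"
  have len: "length P = length ks" by (simp add: P_def)
  have sk: "set ks = (\<lambda>v. S v - 1) ` ?V" using finV by (simp add: ks_def)
  have sorted: "sorted_wrt (<) ks" by (simp add: ks_def)
  have ksl: "ks \<in> color_lists (length P) n"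
    using S1 VI sorted by (fastforce simp: color_lists_def len sk)
  have Pi: "P ! i = {v \<in> ?V. S v = Suc (ks ! i)}" if "i < length ks" for i
    using that by (simp add: P_def)
  have cover: "\<exists>i<length ks. v \<in> P ! i" if v: "v \<in> ?V" for v
  proof -
    have "S v - 1 \<in> set ks" using v sk by auto
    then obtain i where i: "i < length ks" "ks ! i = S v - 1" by (auto simp: in_set_conv_nth)
    moreover have "S v \<ge> 1" using S1 v VI by auto
    ultimately show ?thesis using v Pi by auto
  qed
  have inj: "i = j" if "i < length ks" "j < length ks" "ks ! i = ks ! j" for i j
    using that nth_eq_iff_index_eq[of ks i j] by (simp add: ks_def)
  have "P \<in> decompositions ?V (length P)"
  proof -
    have "\<Union> (set P) = ?V"
      using cover by (fastforce simp: P_def in_set_conv_nth)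
    moreover have "disjoint_family_on (\<lambda>i. P ! i) {..<length P}"
      using inj by (auto simp: disjoint_family_on_def len Pi)
    ultimately show ?thesis by (simp add: decompositions_def)
  qed
  note P' = this
  have "{} \<notin> set P"
  proof
    assume "{} \<in> set P"
    then obtain k where k: "k \<in> set ks" "{v \<in> ?V. S v = Suc k} = {}" by (auto simp: P_def)
    then obtain v where v: "v \<in> ?V" "k = S v - 1" using sk by auto
    then have "S v = Suc k" using S1 VI by fastforce
    with v k show False by auto
  qed
  then have P1: "P \<in> compositions ?V" using P' by (simp add: compositions_def)
  have "part_of P v < part_of P (f x)"
    if x: "x \<in> nonempty_edges H" and v: "v \<in> (fst x - {f x}) \<inter> ?V" for x v
  proof -
    have "f x \<in> ?V" using x by (simp add: orientation_image_def)
    then obtain j where j: "j < length P" "f x \<in> P ! j" using cover len by auto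
    obtain i where i: "i < length P" "v \<in> P ! i" using cover len v by fastforce
    have "S v < S (f x)" using less x v by auto
    then have "ks ! i < ks ! j" using i j Pi len by auto
    then have "i < j" using sorted i(1) j(1) len
      by (metis linorder_less_linear order_less_asym sorted_wrt_iff_nth_less)
    then show ?thesis by (simp add: part_of_eq[OF P' i] part_of_eq[OF P' j])
  qed
  then have P2: "P \<in> compatible_compositions H f"
    using P1 by (simp add: compatible_compositions_def)
  have "S v \<le> ks ! i" if i: "i < length P" and v: "v \<in> tilde_part I H f P i" for v i
  proof -
    have "v \<in> covered_by I H f P i"
      using v by (auto simp: tilde_part_eq_disjointed disjointed_def)
    then obtain x where x: "x \<in> nonempty_edges H" "f x \<in> P ! i" "v \<in> fst x" "v \<notin> ?V"
      by (auto simp: covered_by_def)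
    then have "v \<noteq> f x" by (auto simp: orientation_image_def)
    then have "S v < S (f x)" using less x by auto
    also have "S (f x) = Suc (ks ! i)" using x(2) i Pi len by auto
    finally show ?thesis by simp
  qed
  then have "S \<in> coloring_box I H f n P ks"
    using S Pi len by (auto simp: coloring_box_def colorings_def PiE_iff)
  then show ?thesis using P2 ksl by blast
qed

text \<open>As no part of \<open>P\<close> is empty, every entry of \<open>ks\<close> comes from a
  color taken on the image. A strictly sorted list is determined by its set, so \<open>S\<close>
  determines \<open>ks\<close> and then the fibres \<open>P\<close>. This makes different boxes
  disjoint.\<close>

lemma coloring_box_unique:
  assumes H: "hypergraph I H" and f: "f \<in> orientations H"
    and P: "P \<in> compositions (orientation_image H f)" and ks: "ks \<in> color_lists (length P) n"
    and S: "S \<in> coloring_box I H f n P ks"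
  shows "ks = sorted_list_of_set ((\<lambda>v. S v - 1) ` orientation_image H f)"
    and "P = map (\<lambda>k. {v \<in> orientation_image H f. S v = Suc k}) ks"
proof -
  let ?V = "orientation_image H f"
  have P': "P \<in> decompositions ?V (length P)" using P by (simp add: compositions_def)
  have len: "length ks = length P" and sorted: "sorted_wrt (<) ks"
    using ks by (auto simp: color_lists_def)
  have SP: "S v = Suc (ks ! i)" if "i < length P" "v \<in> P ! i" for v i
    using S that decomposition_part_subset[OF P' that(1)] orientation_image_subset[OF H f]
    by (auto simp: coloring_box_def PiE_iff)
  have "(\<lambda>v. S v - 1) ` ?V = set ks"
  proof
    show "(\<lambda>v. S v - 1) ` ?V \<subseteq> set ks"
    proof clarify
      fix v assume "v \<in> ?V"
      then obtain i where "i < length P" "v \<in> P ! i" by (rule decomposition_cover[OF P'])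
      then show "S v - 1 \<in> set ks" using SP len by simp
    qed
    show "set ks \<subseteq> (\<lambda>v. S v - 1) ` ?V"
    proof
      fix k assume "k \<in> set ks"
      then obtain i where i: "i < length P" "k = ks ! i" using len by (auto simp: in_set_conv_nth)
      then have "P ! i \<noteq> {}" using P nth_mem[OF i(1)] unfolding compositions_def by force
      then obtain v where v: "v \<in> P ! i" by auto
      then have "S v - 1 = k" "v \<in> ?V"
        using SP i decomposition_part_subset[OF P' i(1)] by auto
      then show "k \<in> (\<lambda>v. S v - 1) ` ?V" by blast
    qed
  qed
  then show "ks = sorted_list_of_set ((\<lambda>v. S v - 1) ` ?V)"
    using sorted by (simp add: strict_sorted_iff sorted_list_of_set.idem_if_sorted_distinct)
  show "P = map (\<lambda>k. {v \<in> ?V. S v = Suc k}) ks"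
  proof (rule nth_equalityI)
    fix i assume i: "i < length P"
    have "v \<in> P ! i" if v: "v \<in> ?V" "S v = Suc (ks ! i)" for v
    proof -
      obtain j where j: "j < length P" "v \<in> P ! j" by (rule decomposition_cover[OF P' v(1)])
      then have "ks ! j = ks ! i" using SP v by simp
      then have "j = i" using nth_eq_iff_index_eq[of ks j i] sorted i j len
        by (simp add: strict_sorted_iff)
      then show ?thesis using j by simp
    qed
    then show "P ! i = map (\<lambda>k. {v \<in> ?V. S v = Suc k}) ks ! i"
      using SP i decomposition_part_subset[OF P' i] len by auto
  qed (simp add: len)
qed

text \<open>The box sizes are summed over all pairs of a compatible \<open>P\<close> and a list
  \<open>ks\<close>. The power of \<open>n\<close> is common to all boxes, and the remaining sum
  over \<open>ks\<close> is \<open>F\<close> by definition.\<close>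

lemma card_strictly_compatible:
  assumes H: "hypergraph I H" and f: "f \<in> orientations H"
  shows "card {S \<in> colorings I n. strictly_compatible H f S} =
    n ^ card (isolated_vertices I H) * (\<Sum>P\<in>compatible_compositions H f.
      F (map (\<lambda>i. card (tilde_part I H f P i)) [0..<length P]) n)"
proof -
  let ?V = "orientation_image H f" and ?J = "isolated_vertices I H" and ?T = "tilde_part I H f"
  let ?A = "SIGMA P:compatible_compositions H f. color_lists (length P) n"
  have fin: "finite I" using H by (simp add: hypergraph_def)
  have comp: "compatible_compositions H f \<subseteq> compositions ?V"
    by (auto simp: compatible_compositions_def)
  have finC: "finite (compatible_compositions H f)"
    using finite_subset[OF comp] finite_compositions[of ?V] orientation_image_subset[OF H f] fin
      finite_subset by blast
  then have finA: "finite ?A" by (auto intro: finite_color_lists)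
  have eq: "{S \<in> colorings I n. strictly_compatible H f S} =
      (\<Union>a\<in>?A. coloring_box I H f n (fst a) (snd a))"
    using coloring_box_subset[OF H f] strictly_compatible_in_coloring_box[OF H f]
    by fastforce
  have finB: "finite (coloring_box I H f n P ks)" for P ks
    unfolding coloring_box_def using fin by (intro finite_PiE) auto
  have disj: "coloring_box I H f n (fst a) (snd a) \<inter> coloring_box I H f n (fst b) (snd b) = {}"
    if "a \<in> ?A" "b \<in> ?A" "a \<noteq> b" for a b
  proof (rule ccontr)
    assume "\<not> ?thesis"
    then obtain S where S: "S \<in> coloring_box I H f n (fst a) (snd a)"
      "S \<in> coloring_box I H f n (fst b) (snd b)" by auto
    have ab: "fst a \<in> compositions ?V" "snd a \<in> color_lists (length (fst a)) n"
      "fst b \<in> compositions ?V" "snd b \<in> color_lists (length (fst b)) n"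
      using that comp by auto
    have "snd a = snd b"
      using coloring_box_unique(1)[OF H f ab(1,2) S(1)] coloring_box_unique(1)[OF H f ab(3,4) S(2)]
      by simp
    moreover from this have "fst a = fst b"
      using coloring_box_unique(2)[OF H f ab(1,2) S(1)] coloring_box_unique(2)[OF H f ab(3,4) S(2)]
      by simp
    ultimately show False using that(3) by (simp add: prod_eq_iff)
  qed
  have "card {S \<in> colorings I n. strictly_compatible H f S} =
      (\<Sum>a\<in>?A. card (coloring_box I H f n (fst a) (snd a)))"
    unfolding eq using finA finB disj by (intro card_UN_disjoint) auto
  also have "\<dots> = (\<Sum>P\<in>compatible_compositions H f. \<Sum>ks\<in>color_lists (length P) n.
      card (coloring_box I H f n P ks))"
    using finC finite_color_lists by (subst sum.Sigma) (auto simp: case_prod_beta)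
  also have "\<dots> = (\<Sum>P\<in>compatible_compositions H f. \<Sum>ks\<in>color_lists (length P) n.
      n ^ card ?J * (\<Prod>i<length P. (ks ! i) ^ card (?T P i)))"
    using card_coloring_box[OF H f] comp by (intro sum.cong) auto
  also have "\<dots> = n ^ card ?J * (\<Sum>P\<in>compatible_compositions H f.
      F (map (\<lambda>i. card (?T P i)) [0..<length P]) n)"
    by (simp add: F_def color_lists_def sum_distrib_left)
  finally show ?thesis .
qed

theorem theorem11:
  fixes I :: "'a set" and H :: "'a set multiset" and n :: nat
  assumes "hypergraph I H"
  shows
    "chi I H n =
       card {S \<in> colorings I n. \<forall>e\<in>#H. e \<noteq> {} \<longrightarrow> (\<exists>!v. maximal_vertex S e v)}
     \<and> chi I H n =
       card {(f, S). f \<in> acyclic_orientations H \<and> S \<in> colorings I n \<and> strictly_compatible H f S}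
     \<and> chi I H n =
       n ^ card (isolated_vertices I H) *
       (\<Sum>f\<in>acyclic_orientations H. \<Sum>P\<in>compatible_compositions H f.
          F (map (\<lambda>i. card (tilde_part I H f P i)) [0..<length P]) n)"
proof -
  let ?C = "\<lambda>f. {S \<in> colorings I n. strictly_compatible H f S}"
  let ?P = "{(f, S). f \<in> acyclic_orientations H \<and> S \<in> colorings I n \<and> strictly_compatible H f S}"
  have chi_pairs: "chi I H n = card ?P"
    unfolding chi_eq_card_colorings[OF assms] by (rule card_colorings_eq_card_pairs[OF assms])
  \<comment> \<open>The pairs are fibred over the acyclic orientations, and
    \<open>card_strictly_compatible\<close> counts each fibre.\<close>
  have pairs: "?P = Sigma (acyclic_orientations H) ?C" by auto
  have "card ?P = (\<Sum>f\<in>acyclic_orientations H. card (?C f))"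
    unfolding pairs
    using finite_acyclic_orientations[OF assms] finite_colorings[of I n] assms
    by (intro card_SigmaI) (auto simp: hypergraph_def)
  also have "\<dots> = n ^ card (isolated_vertices I H) *
      (\<Sum>f\<in>acyclic_orientations H. \<Sum>P\<in>compatible_compositions H f.
          F (map (\<lambda>i. card (tilde_part I H f P i)) [0..<length P]) n)"
    unfolding sum_distrib_left[of _ _ "acyclic_orientations H"]
    by (intro sum.cong) (auto simp: card_strictly_compatible[OF assms] acyclic_orientations_def)
  finally have "card ?P = n ^ card (isolated_vertices I H) *
      (\<Sum>f\<in>acyclic_orientations H. \<Sum>P\<in>compatible_compositions H f.
          F (map (\<lambda>i. card (tilde_part I H f P i)) [0..<length P]) n)" .
  with chi_pairs show ?thesis
    by (intro conjI chi_eq_card_colorings[OF assms] chi_pairs) (rule trans)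
qed

end
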